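(* Let $q$ be a prime power, let $n\geq1$ and $0\leq k\leq n$ be integers, and let $E\subseteq\mathbb{F}_q^n$. Then $$\mathcal{E}_0(E,A(k,n))=q^{n-k}\binom{n}{k}_q,$$ $$\mathcal{E}_1(E,A(k,n))=|E|\binom{n}{k}_q,$$ $$\mathcal{E}_2(E,A(k,n))=|E|\,q^k\binom{n-1}{k}_q+|E|^2\binom{n-1}{k-1}_q.$$
   Context: $\mathbb{F}_q$ is the finite field with $q$ elements and $|X|$ is the cardinality of a finite set $X$. $G(k,n)$ is the set of all $k$-dimensional linear subspaces of $\mathbb{F}_q^n$, and $A(k,n)=\{x+V: x\in\mathbb{F}_q^n,\ V\in G(k,n)\}$ is the set of all $k$-dimensional affine subspaces ($k$-planes) of $\mathbb{F}_q^n$. For $\mathcal{A}\subseteq A(k,n)$ and a non-negative integer $r$, the $r$th moment of $E$ over $\mathcal{A}$ is $\mathcal{E}_r(E,\mathcal{A})=\sum_{A\in\mathcal{A}}|E\cap A|^r$, with the convention $0^0=1$ (so that $\mathcal{E}_0(E,\mathcal{A})=|\mathcal{A}|$). The Gaussian binomial coefficient is $$\binom{n}{k}_q=\frac{(q^n-1)(q^n-q)\cdots(q^n-q^{k-1})}{(q^k-1)(q^k-q)\cdots(q^k-q^{k-1})}\quad\text{if }0\leq k\leq n,$$ (equal to $1$ for $k=0$), and $\binom{n}{k}_q=0$ if $k>n$. By convention $\binom{n-1}{-1}_q=0$. *)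

theory Defs
  imports "HOL-Analysis.Cartesian_Space"
begin

(* F_q^n is rendered as 'a ^ 'n with 'a a finite field, q = CARD('a), n = CARD('n).
   The subspaces and dimensions are those of the F_q-vector space structure given by *s. *)

definition grassmannian :: "nat \<Rightarrow> ('a::field ^ 'n) set set" where
  "grassmannian k = {V. vec.subspace V \<and> vec.dim V = k}"

definition affine_planes :: "nat \<Rightarrow> ('a::field ^ 'n) set set" where
  "affine_planes k = {(+) x ` V | x V. V \<in> grassmannian k}"

(* The convention 0^0 = 1 is that of the library power operation on nat. *)
definition moment :: "nat \<Rightarrow> 'v set \<Rightarrow> 'v set set \<Rightarrow> nat" where
  "moment r E \<A> = (\<Sum>A\<in>\<A>. card (E \<inter> A) ^ r)"

(* The lower index is an integer, so that it may take the value -1, where the coefficient is 0. *)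
definition gauss_binomial :: "nat \<Rightarrow> nat \<Rightarrow> int \<Rightarrow> real" where
  "gauss_binomial q n k =
     (if 0 \<le> k \<and> k \<le> int n
      then (\<Prod>i<nat k. real q ^ n - real q ^ i) / (\<Prod>i<nat k. real q ^ nat k - real q ^ i)
      else 0)"

end

theory Submission imports Defs begin

text \<open>The pairs (subspace of dimension \<open>k\<close> containing \<open>W\<close>, list completing \<open>W\<close> to a
  spanning set without redundancy) are determined by the list alone, which counts the subspaces of
  dimension \<open>k\<close> through \<open>W\<close>. The planes through two points \<open>x\<close>, \<open>y\<close> correspond to the
  subspaces containing \<open>y - x\<close>, so the first and second moments follow by double counting and the
  \<open>q\<close>-Pascal identity; the zeroth moment is the first moment of the whole space.\<close>

section \<open>Gaussian binomial coefficients\<close>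

text \<open>For \<open>k\<close> \<le> \<open>n\<close> and a prime power \<open>q\<close>, this is
  the number of linearly independent \<open>k\<close>-tuples in an \<open>n\<close>-dimensional
  space over the field of \<open>q\<close> elements.\<close>

definition gauss_prod :: "nat \<Rightarrow> nat \<Rightarrow> nat \<Rightarrow> real" where
  "gauss_prod q n k = (\<Prod>i<k. real q ^ n - real q ^ i)"

lemma gauss_prod_pos:
  assumes "2 \<le> q" and "k \<le> n" shows "0 < gauss_prod q n k"
  unfolding gauss_prod_def
proof (rule prod_pos)
  fix i assume "i \<in> {..<k}"
  with assms show "0 < real q ^ n - real q ^ i"
    by (simp add: power_strict_increasing)
qed

text \<open>If \<open>k > n\<close>, the factor with \<open>i = n\<close> in the numerator vanishes,
  in agreement with the default value 0.\<close>

lemma gauss_binomial_eq: "gauss_binomial q n (int k) = gauss_prod q n k / gauss_prod q k k"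
  by (cases "k \<le> n") (auto simp: gauss_binomial_def gauss_prod_def)

lemma gauss_prod_shift:
  "(\<Prod>i<k. real q ^ Suc n - real q ^ Suc i) = real q ^ k * gauss_prod q n k"
  by (induction k) (simp_all add: gauss_prod_def algebra_simps)

lemma gauss_prod_Suc_Suc:
  "gauss_prod q (Suc n) (Suc k) = (real q ^ Suc n - 1) * real q ^ k * gauss_prod q n k"
proof -
  have "gauss_prod q (Suc n) (Suc k)
      = (real q ^ Suc n - 1) * (\<Prod>i<k. real q ^ Suc n - real q ^ Suc i)"
    unfolding gauss_prod_def prod.lessThan_Suc_shift by simp
  then show ?thesis
    unfolding gauss_prod_shift by simp
qed

text \<open>For \<open>k = j + 1\<close>, a common denominator reduces this to q^(n+1) - 1 =
  (q^(n+1) - q^(j+1)) + (q^(j+1) - 1). For \<open>k = 0\<close> the last coefficient has lower index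
  -1 and is 0.\<close>

lemma gauss_binomial_Pascal:
  assumes "2 \<le> q"
  shows "gauss_binomial q (Suc n) (int k)
    = real q ^ k * gauss_binomial q n (int k) + gauss_binomial q n (int k - 1)"
proof (cases k)
  case 0
  then show ?thesis
    by (simp add: gauss_binomial_def)
next
  case (Suc j)
  have "int k - 1 = int j"
    using Suc by simp
  moreover have "gauss_prod q j j \<noteq> 0"
    using gauss_prod_pos[OF assms order_refl, of j] by simp
  moreover have "real q ^ Suc j - 1 \<noteq> 0"
    using power_gt1[of "real q" j] assms by simp
  moreover have "gauss_prod q n (Suc j) = gauss_prod q n j * (real q ^ n - real q ^ j)"
    by (simp add: gauss_prod_def)
  ultimately show ?thesis
    using assms Suc
    by (simp only: gauss_binomial_eq gauss_prod_Suc_Suc) (simp add: field_simps)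
qed

section \<open>Subspaces of a finite vector space\<close>

text \<open>Writing an element as \<open>c *s b + y\<close> with \<open>y\<close> in
  \<open>vec.span B\<close> is unique: two different coefficients would, after division by their
  difference, put \<open>b\<close> into the span.\<close>

lemma card_span_insert:
  fixes B :: "('a::{field,finite} ^ 'n::finite) set"
  assumes "b \<notin> vec.span B"
  shows "card (vec.span (insert b B)) = CARD('a) * card (vec.span B)"
proof -
  let ?f = "\<lambda>(c::'a, y). c *s b + y"
  have "inj_on ?f (UNIV \<times> vec.span B)"
  proof (rule inj_onI, clarify)
    fix c d :: 'a and y z
    assume y: "y \<in> vec.span B" "z \<in> vec.span B" and eq: "c *s b + y = d *s b + z"
    then have *: "(c - d) *s b = z - y"
      by (simp add: vec.scale_left_diff_distrib algebra_simps)
    have "c = d"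
    proof (rule ccontr)
      assume "c \<noteq> d"
      then have "b = inverse (c - d) *s (z - y)"
        unfolding *[symmetric] by simp
      then show False
        using assms y by (metis vec.span_diff vec.span_scale)
    qed
    then show "c = d \<and> y = z"
      using eq by simp
  qed
  moreover have "?f ` (UNIV \<times> vec.span B) = vec.span (insert b B)"
  proof (intro equalityI subsetI)
    fix x assume "x \<in> ?f ` (UNIV \<times> vec.span B)"
    then show "x \<in> vec.span (insert b B)"
      by (auto simp: vec.span_insert) (metis add_diff_cancel_left')
  next
    fix x assume "x \<in> vec.span (insert b B)"
    then obtain c where "x - c *s b \<in> vec.span B"
      using vec.span_breakdown_eq by blast
    then show "x \<in> ?f ` (UNIV \<times> vec.span B)"
      by (intro image_eqI[of _ _ "(c, x - c *s b)"]) auto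
  qed
  ultimately show ?thesis
    by (metis card_image card_cartesian_product)
qed

lemma card_span:
  fixes S :: "('a::{field,finite} ^ 'n::finite) set"
  shows "card (vec.span S) = CARD('a) ^ vec.dim S"
  using finite[of S]
proof (induction S rule: finite_induct)
  case empty
  then show ?case by simp
next
  case (insert x S)
  then show ?case
    by (cases "x \<in> vec.span S") (simp_all add: vec.span_redundant vec.dim_insert card_span_insert)
qed

lemma card_subspace:
  fixes V :: "('a::{field,finite} ^ 'n::finite) set"
  assumes "vec.subspace V"
  shows "card V = CARD('a) ^ vec.dim V"
  using card_span[of V] assms by (metis vec.span_eq_iff)

text \<open>The dimension condition makes the list independent modulo the span of \<open>W\<close>,
  while \<open>W\<close> itself may be dependent. Lists instead of sets allow the entries to be
  chosen one after another.\<close>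

definition extensions ::
    "('a::field ^ 'n) set \<Rightarrow> ('a ^ 'n) set \<Rightarrow> nat \<Rightarrow> ('a ^ 'n) list set" where
  "extensions U W j =
     {xs. length xs = j \<and> set xs \<subseteq> U \<and> vec.dim (W \<union> set xs) = vec.dim W + j}"

lemma finite_extensions:
  fixes U :: "('a::{field,finite} ^ 'n::finite) set"
  shows "finite (extensions U W j)"
  by (rule finite_subset[OF _ finite_lists_length_eq[OF finite[of U], of j]])
    (auto simp: extensions_def)

lemma dim_Un_list_le:
  fixes W :: "('a::field ^ 'n::finite) set"
  shows "vec.dim (W \<union> set xs) \<le> vec.dim W + length xs"
  by (induction xs) (auto simp: vec.dim_insert)

lemma extensions_Suc:
  fixes U W :: "('a::field ^ 'n::finite) set"
  shows "extensions U W (Suc j)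
    = (\<Union>x\<in>U - vec.span W. (#) x ` extensions U (insert x W) j)" (is "?L = ?R")
proof (intro equalityI subsetI)
  fix zs assume zs: "zs \<in> ?L"
  then obtain x ys where [simp]: "zs = x # ys"
    by (cases zs) (auto simp: extensions_def)
  have "vec.dim (insert x W \<union> set ys) \<le> vec.dim (insert x W) + length ys"
    by (rule dim_Un_list_le)
  with zs show "zs \<in> ?R"
    by (auto simp: extensions_def vec.dim_insert split: if_splits)
next
  fix zs assume "zs \<in> ?R"
  then show "zs \<in> ?L"
    by (auto simp: extensions_def vec.dim_insert split: if_splits)
qed

text \<open>After \<open>i\<close> choices the span has \<open>CARD('a) ^ (vec.dim W + i)\<close>
  elements, and the next entry is any element of \<open>U\<close> outside it. If \<open>j\<close>
  exceeds \<open>vec.dim U - vec.dim W\<close>, one factor is zero.\<close>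

lemma card_extensions:
  fixes U W :: "('a::{field,finite} ^ 'n::finite) set"
  assumes "vec.subspace U" and "W \<subseteq> U"
  shows "real (card (extensions U W j))
    = (\<Prod>i<j. real CARD('a) ^ vec.dim U - real CARD('a) ^ (vec.dim W + i))"
  using assms(2)
proof (induction j arbitrary: W)
  case 0
  have "extensions U W 0 = {[]}"
    by (auto simp: extensions_def)
  then show ?case by simp
next
  case (Suc j)
  let ?q = "real CARD('a)"
  have sub: "vec.span W \<subseteq> U"
    using Suc.prems assms(1) by (simp add: vec.span_minimal)
  \<comment> \<open>The inequality keeps the difference of natural numbers from being truncated, so
    it passes to the reals.\<close>
  have "card (vec.span W) \<le> card U" and "card (U - vec.span W) = card U - card (vec.span W)"
    using sub by (simp_all add: card_mono card_Diff_subset)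
  then have card: "real (card (U - vec.span W)) = ?q ^ vec.dim U - ?q ^ vec.dim W"
    by (simp only: of_nat_diff card_span card_subspace[OF assms(1)] of_nat_power)
  have "card (extensions U W (Suc j))
      = (\<Sum>x\<in>U - vec.span W. card ((#) x ` extensions U (insert x W) j))"
    unfolding extensions_Suc by (rule card_UN_disjoint) (auto intro: finite_extensions)
  also have "\<dots> = (\<Sum>x\<in>U - vec.span W. card (extensions U (insert x W) j))"
    by (simp add: card_image)
  also have "real \<dots> = (\<Sum>x\<in>U - vec.span W.
      \<Prod>i<j. ?q ^ vec.dim U - ?q ^ (vec.dim W + Suc i))"
    unfolding of_nat_sum
  proof (rule sum.cong[OF refl])
    fix x assume "x \<in> U - vec.span W"
    then show "real (card (extensions U (insert x W) j))
        = (\<Prod>i<j. ?q ^ vec.dim U - ?q ^ (vec.dim W + Suc i))"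
      using Suc.IH[of "insert x W"] Suc.prems by (simp add: vec.dim_insert)
  qed
  also have "\<dots> = (\<Prod>i<Suc j. ?q ^ vec.dim U - ?q ^ (vec.dim W + i))"
    unfolding prod.lessThan_Suc_shift using card by simp
  finally show ?case .
qed

text \<open>A list determines a suitable \<open>V\<close>, namely the span of \<open>W\<close> and
  its entries.\<close>

lemma extensions_UNIV:
  fixes W :: "('a::field ^ 'n::finite) set"
  shows "extensions UNIV W j
    = (\<Union>V\<in>{V \<in> grassmannian (vec.dim W + j). W \<subseteq> V}. extensions V W j)"
proof (intro equalityI subsetI)
  fix xs assume xs: "xs \<in> extensions UNIV W j"
  let ?V = "vec.span (W \<union> set xs)"
  have "?V \<in> grassmannian (vec.dim W + j)" "W \<subseteq> ?V" "xs \<in> extensions ?V W j"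
    using xs by (auto simp: grassmannian_def extensions_def intro: vec.span_base)
  then show "xs \<in> (\<Union>V\<in>{V \<in> grassmannian (vec.dim W + j). W \<subseteq> V}. extensions V W j)"
    by blast
qed (auto simp: extensions_def)

text \<open>The span lies in \<open>V\<close> and has the same dimension. Hence the union in
  \<open>extensions_UNIV\<close> is disjoint.\<close>

lemma span_extension:
  fixes W :: "('a::field ^ 'n::finite) set"
  assumes "V \<in> grassmannian (vec.dim W + j)" and "W \<subseteq> V" and "xs \<in> extensions V W j"
  shows "vec.span (W \<union> set xs) = V"
  using assms vec.subspace_dim_equal[of "vec.span (W \<union> set xs)" V]
  by (auto simp: grassmannian_def extensions_def vec.span_minimal)

text \<open>The extensions in the whole space fall into disjoint classes, one for each
  \<open>V\<close>; the product on the left is the common size of these classes.\<close>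

lemma card_grassmannian_superset:
  fixes W :: "('a::{field,finite} ^ 'n::finite) set"
  assumes "vec.dim W + j = k"
  shows "real (card {V \<in> grassmannian k. W \<subseteq> V})
        * (\<Prod>i<j. real CARD('a) ^ k - real CARD('a) ^ (vec.dim W + i))
    = (\<Prod>i<j. real CARD('a) ^ CARD('n) - real CARD('a) ^ (vec.dim W + i))"
proof -
  let ?G = "{V \<in> grassmannian k. W \<subseteq> V}"
  let ?P = "\<lambda>n. \<Prod>i<j. real CARD('a) ^ n - real CARD('a) ^ (vec.dim W + i)"
  have "card (extensions UNIV W j) = (\<Sum>V\<in>?G. card (extensions V W j))"
    unfolding extensions_UNIV assms
  proof (rule card_UN_disjoint)
    show "\<forall>V\<in>?G. \<forall>V'\<in>?G. V \<noteq> V' \<longrightarrow> extensions V W j \<inter> extensions V' W j = {}"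
      using span_extension assms by blast
  qed (auto intro: finite_extensions)
  also have "real \<dots> = (\<Sum>V\<in>?G. ?P k)"
    unfolding of_nat_sum by (rule sum.cong) (auto simp: card_extensions grassmannian_def)
  finally show ?thesis
    using card_extensions[of UNIV W j]
    by (simp add: card_cart_basis)
qed

lemma card_field_ge_2: "2 \<le> CARD('a::{field,finite})"
  using card_mono[of UNIV "{0, 1 :: 'a}"] by simp

lemma card_grassmannian:
  "real (card (grassmannian k :: ('a::{field,finite} ^ 'n::finite) set set))
    = gauss_binomial CARD('a) CARD('n) (int k)"
proof -
  have "real (card (grassmannian k :: ('a ^ 'n) set set)) * gauss_prod CARD('a) k k
      = gauss_prod CARD('a) CARD('n) k"
    using card_grassmannian_superset[of "{} :: ('a ^ 'n) set" k k] by (simp add: gauss_prod_def)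
  then show ?thesis
    using gauss_prod_pos[OF card_field_ge_2[where 'a='a] order_refl[of k]]
    by (simp add: gauss_binomial_eq field_simps)
qed

text \<open>For \<open>W = {v}\<close> the exponents start at 1. Taking one power of the field size
  out of each factor lowers both parameters by one, and the extracted powers cancel.\<close>

lemma card_grassmannian_through:
  fixes v :: "'a::{field,finite} ^ 'n::finite"
  assumes "v \<noteq> 0"
  shows "real (card {V \<in> grassmannian k. v \<in> V})
    = gauss_binomial CARD('a) (CARD('n) - 1) (int k - 1)"
proof (cases k)
  case 0
  \<comment> \<open>The only subspace of dimension 0 is the zero space, which misses
    \<open>v\<close>; the lower index on the right is -1.\<close>
  have "{V \<in> grassmannian k. v \<in> V} = {}"
    using assms 0 by (auto simp: grassmannian_def)
  then show ?thesis
    using 0 by (simp add: gauss_binomial_def)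
next
  case (Suc j)
  let ?q = "CARD('a)"
  obtain m where m: "CARD('n) = Suc m"
    using not0_implies_Suc zero_less_card_finite by fastforce
  have "vec.dim {v} = 1"
    using assms by (simp add: vec.dim_insert)
  then have "real (card {V \<in> grassmannian k. v \<in> V}) * (real ?q ^ j * gauss_prod ?q j j)
      = real ?q ^ j * gauss_prod ?q m j"
    using card_grassmannian_superset[of "{v}" j k] Suc m by (simp flip: gauss_prod_shift)
  then show ?thesis
    using gauss_prod_pos[OF card_field_ge_2[where 'a='a] order_refl[of j]] Suc m
    by (simp add: gauss_binomial_eq field_simps)
qed

section \<open>Incidences of points and planes\<close>

text \<open>Any point of a plane can serve as its base point, since \<open>x - y\<close> in
  \<open>V\<close> makes the translates of \<open>V\<close> by \<open>x\<close> and \<open>y\<close>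
  coincide. With \<open>x\<close> fixed, only the direction \<open>V\<close> varies.\<close>

lemma affine_planes_through:
  "{A \<in> affine_planes k. x \<in> A} = (\<lambda>V. (+) x ` V) ` grassmannian k"
proof (intro equalityI subsetI)
  fix A assume "A \<in> {A \<in> affine_planes k. x \<in> A}"
  then obtain y V where A: "A = (+) y ` V" "V \<in> grassmannian k" "x \<in> A"
    by (auto simp: affine_planes_def)
  then have V: "vec.subspace V" and "x - y \<in> V"
    by (auto simp: grassmannian_def)
  have "(+) y ` V = (+) x ` V"
  proof (intro equalityI subsetI)
    fix z assume "z \<in> (+) y ` V"
    then obtain v where "v \<in> V" "z = y + v" by blast
    then show "z \<in> (+) x ` V"
      using vec.subspace_diff[OF V _ \<open>x - y \<in> V\<close>] by (intro image_eqI[of _ _ "v - (x - y)"]) auto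
  next
    fix z assume "z \<in> (+) x ` V"
    then obtain v where "v \<in> V" "z = x + v" by blast
    then show "z \<in> (+) y ` V"
      using vec.subspace_add[OF V _ \<open>x - y \<in> V\<close>] by (intro image_eqI[of _ _ "v + (x - y)"]) auto
  qed
  then show "A \<in> (\<lambda>V. (+) x ` V) ` grassmannian k"
    using A by blast
next
  fix A assume "A \<in> (\<lambda>V. (+) x ` V) ` grassmannian k"
  then show "A \<in> {A \<in> affine_planes k. x \<in> A}"
    by (force simp: affine_planes_def grassmannian_def dest: vec.subspace_0)
qed

lemma inj_image_translation: "inj (\<lambda>V. (+) (x :: 'b::group_add) ` V)"
  by (intro inj_onI) (simp add: inj_image_eq_iff)

lemma card_affine_planes_through:
  fixes x :: "'a::field ^ 'n"
  shows "card {A \<in> affine_planes k. x \<in> A} = card (grassmannian k :: ('a ^ 'n) set set)"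
  unfolding affine_planes_through
  by (rule card_image) (rule inj_on_subset[OF inj_image_translation subset_UNIV])

text \<open>A translate of \<open>V\<close> by \<open>x\<close> contains \<open>y\<close> exactly
  when \<open>V\<close> contains \<open>y - x\<close>, so the correspondence for planes through
  \<open>x\<close> restricts.\<close>

lemma card_affine_planes_through_two:
  fixes x y :: "'a::field ^ 'n"
  shows "card {A \<in> affine_planes k. x \<in> A \<and> y \<in> A} = card {V \<in> grassmannian k. y - x \<in> V}"
proof -
  have "{A \<in> affine_planes k. x \<in> A \<and> y \<in> A} = {A \<in> {A \<in> affine_planes k. x \<in> A}. y \<in> A}"
    by auto
  also have "\<dots> = (\<lambda>V. (+) x ` V) ` {V \<in> grassmannian k. y - x \<in> V}"
    unfolding affine_planes_through by (force simp: image_iff algebra_simps)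
  finally show ?thesis
    by (simp only: card_image[OF inj_on_subset[OF inj_image_translation subset_UNIV]])
qed

lemma card_eq_sum_of_bool:
  "finite S \<Longrightarrow> card {x \<in> S. P x} = (\<Sum>x\<in>S. of_bool (P x))"
  by (simp add: Int_def)

lemma moment_1_eq_sum:
  fixes E :: "'v::finite set"
  shows "moment 1 E \<A> = (\<Sum>x\<in>E. card {A \<in> \<A>. x \<in> A})"
proof -
  have "moment 1 E \<A> = (\<Sum>A\<in>\<A>. \<Sum>x\<in>E. of_bool (x \<in> A))"
    by (simp only: moment_def power_one_right Int_def card_eq_sum_of_bool[OF finite])
  also have "\<dots> = (\<Sum>x\<in>E. \<Sum>A\<in>\<A>. of_bool (x \<in> A))"
    by (rule sum.swap)
  finally show ?thesis
    by (simp only: card_eq_sum_of_bool[OF finite])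
qed

lemma moment_2_eq_sum:
  fixes E :: "'v::finite set"
  shows "moment 2 E \<A> = (\<Sum>x\<in>E. \<Sum>y\<in>E. card {A \<in> \<A>. x \<in> A \<and> y \<in> A})"
proof -
  \<comment> \<open>The square counts ordered pairs of points, the diagonal \<open>x = y\<close>
    included.\<close>
  have sq: "card (E \<inter> A) ^ 2 = (\<Sum>x\<in>E. \<Sum>y\<in>E. of_bool (x \<in> A \<and> y \<in> A))" for A
  proof -
    have "card (E \<inter> A) = (\<Sum>x\<in>E. of_bool (x \<in> A))"
      by (simp only: Int_def mem_Collect_eq card_eq_sum_of_bool[OF finite])
    then show ?thesis
      by (simp only: power2_eq_square sum_product of_bool_conj)
  qed
  have "moment 2 E \<A> = (\<Sum>A\<in>\<A>. \<Sum>x\<in>E. \<Sum>y\<in>E. of_bool (x \<in> A \<and> y \<in> A))"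
    by (simp only: moment_def sq)
  also have "\<dots> = (\<Sum>x\<in>E. \<Sum>A\<in>\<A>. \<Sum>y\<in>E. of_bool (x \<in> A \<and> y \<in> A))"
    by (rule sum.swap)
  also have "\<dots> = (\<Sum>x\<in>E. \<Sum>y\<in>E. \<Sum>A\<in>\<A>. of_bool (x \<in> A \<and> y \<in> A))"
    by (rule sum.cong[OF refl], rule sum.swap)
  finally show ?thesis
    by (simp only: card_eq_sum_of_bool[OF finite])
qed

lemma card_affine_plane:
  fixes A :: "('a::{field,finite} ^ 'n::finite) set"
  assumes "A \<in> affine_planes k"
  shows "card A = CARD('a) ^ k"
proof -
  obtain x V where "A = (+) x ` V" "vec.subspace V" "vec.dim V = k"
    using assms by (auto simp: affine_planes_def grassmannian_def)
  then show ?thesis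
    by (simp add: card_image card_subspace)
qed

theorem lemma8p4:
  fixes q n k :: nat and E :: "('a::{field,finite} ^ 'n::finite) set"
  assumes "CARD('a) = q" and "CARD('n) = n" and "k \<le> n"
  shows "real (moment 0 E (affine_planes k)) =
           real q ^ (n - k) * gauss_binomial q n (int k)
    \<and> real (moment 1 E (affine_planes k)) =
           real (card E) * gauss_binomial q n (int k)
    \<and> real (moment 2 E (affine_planes k)) =
           real (card E) * real q ^ k * gauss_binomial q (n - 1) (int k) +
           real (card E) ^ 2 * gauss_binomial q (n - 1) (int k - 1)"
proof (intro conjI)
  have q: "2 \<le> q"
    using card_field_ge_2[where 'a='a] assms(1) by simp
  have n: "Suc (n - 1) = n"
    using zero_less_card_finite[where 'a='n] assms(2) by simp
  \<comment> \<open>An arbitrary \<open>F\<close> is allowed because the zeroth moment needs the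
    case of the whole space.\<close>
  have moment_1: "real (moment 1 F (affine_planes k)) = real (card F) * gauss_binomial q n (int k)"
    for F :: "('a ^ 'n) set"
    unfolding moment_1_eq_sum card_affine_planes_through
    using card_grassmannian[where 'a='a and 'n='n, of k] assms by simp
  then show "real (moment 1 E (affine_planes k)) = real (card E) * gauss_binomial q n (int k)" .
  \<comment> \<open>Each plane has \<open>q ^ k\<close> points, so the first moment of the whole
    space is the number of planes times \<open>q ^ k\<close>.\<close>
  have "real q ^ k * real (moment 0 E (affine_planes k))
      = real (moment 1 (UNIV :: ('a ^ 'n) set) (affine_planes k))"
    using assms(1) by (simp add: moment_def card_affine_plane)
  also have "\<dots> = real q ^ k * (real q ^ (n - k) * gauss_binomial q n (int k))"
    unfolding moment_1 using assms by (simp flip: power_add mult.assoc)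
  finally show "real (moment 0 E (affine_planes k)) = real q ^ (n - k) * gauss_binomial q n (int k)"
    using q by simp
  let ?G = "gauss_binomial q n (int k)" and ?H = "gauss_binomial q (n - 1) (int k - 1)"
  \<comment> \<open>Writing the count as the off-diagonal value \<open>?H\<close> plus a correction
    on the diagonal splits the double sum into a linear and a quadratic term in
    \<open>card E\<close>.\<close>
  have count: "real (card {V \<in> grassmannian k. y - x \<in> V}) = (if x = y then ?G - ?H else 0) + ?H"
    for x y :: "'a ^ 'n"
  proof (cases "x = y")
    case True
    then have "{V \<in> grassmannian k. y - x \<in> V} = grassmannian k"
      by (auto simp: grassmannian_def vec.subspace_0)
    with True show ?thesis
      using card_grassmannian[where 'a='a and 'n='n, of k] assms by simp
  next
    case False
    then show ?thesis
      using card_grassmannian_through[of "y - x" k] assms by simp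
  qed
  have "real (moment 2 E (affine_planes k))
      = (\<Sum>x\<in>E. \<Sum>y\<in>E. (if x = y then ?G - ?H else 0) + ?H)"
    by (simp add: moment_2_eq_sum card_affine_planes_through_two count)
  also have "\<dots> = real (card E) * (?G - ?H) + real (card E) ^ 2 * ?H"
    by (simp add: sum.distrib power2_eq_square algebra_simps)
  \<comment> \<open>The diagonal correction is the remaining term of the Pascal identity at
    \<open>n - 1\<close>.\<close>
  also have "?G - ?H = real q ^ k * gauss_binomial q (n - 1) (int k)"
    using gauss_binomial_Pascal[OF q, of "n - 1" k] n by simp
  finally show "real (moment 2 E (affine_planes k)) =
      real (card E) * real q ^ k * gauss_binomial q (n - 1) (int k) + real (card E) ^ 2 * ?H"
    by (simp add: mult.assoc)
qed

end
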